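(* Let $B\subset S$ be any set of patterns with $1\notin B$. Suppose that $D[B]$ is an almost path-directed graph with parameters $V'=\{v_0,v_1,\dots\}$ and $W$. If for each $w\in W$ the generating function $\sum_{j\geq 0}M[B](v_j,w)x^j$ is rational, then $G_B(x)$ is rational (i.e. it is the power series expansion at $0$ of a rational function of $x$).
   Context: Permutations and patterns. $S_n$ is the set of permutations of $[n]=\{1,\dots,n\}$ written as words, $S=\bigcup_{n\ge1}S_n$, and $|\pi|=n$ for $\pi\in S_n$. The permutation of length one is denoted $1$. A permutation $\sigma\in S_n$ contains $\tau\in S_k$ if there are indices $i_1<\dots<i_k$ such that $\sigma(i_a)<\sigma(i_b)$ iff $\tau(a)<\tau(b)$ for all $a,b$; otherwise it avoids $\tau$. $S_n(B)$ is the set of permutations in $S_n$ avoiding every $\tau\in B$, $S(B)=\bigcup_{n\ge 1}S_n(B)$, and $G_B(x)=\sum_{n\ge1}|S_n(B)|x^n$. Pattern-avoidance tree. $T(B)$ is the rooted tree with root $1$ whose $n$-th level is $S_n(B)$ (the root is level $1$); the parent of $\pi\in S_n(B)$, $n\ge2$, is the permutation in $S_{n-1}(B)$ obtained by deleting the letter $n$ from $\pi$. For $\pi\in S(B)$, $T(B;\pi)$ is the subtree of $T(B)$ consisting of $\pi$ and all its descendants, with root $\pi$. Call $\pi,\pi'\in S(B)$ equivalent if $T(B;\pi)\cong T(B;\pi')$ as rooted trees. Each equivalence class is labeled by one fixed representative of minimal length in the class. The directed graph $D[B]$ and matrix $M[B]$. The nodes of $D[B]$ are these representatives (one per equivalence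 class). For nodes $v,w$, the number of edges from $v$ to $w$ is the number of children of $v$ in $T(B)$ that are equivalent to $w$ (so loops and multiple edges are allowed); this number is denoted $M[B](v,w)$. The length $|v|$ of a node $v$ is its length as a permutation. Almost path-directed graphs. A directed graph $G=(V,E)$ with $V\subset S$ (edges may have multiplicities) is almost path-directed with parameters $V'$ and $W$ if $V$ is partitioned as $V=V'\cup W$, where $V'=\{v_0,v_1,\dots\}$ and $|v_i|=i+m$ for all $i\ge0$ with $m\ge1$ fixed, such that: (i) every node in $W=V\setminus V'$ has length at most $m$; (ii) $(v_j,v_{j+1})\in E$ for all $j\ge0$, and this edge is not repeated (multiplicity one); (iii) all other edges $(c,d)\in E$ may be repeated (with $c=d$ possible) and are such that $c$ or $d$ belongs to $W$ (possibly both). *)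

theory Defs
  imports
    "HOL-Combinatorics.Multiset_Permutations"
    "HOL-Computational_Algebra.Polynomial_FPS"
begin

text \<open>
  A permutation of \<open>{1..n}\<close> is the list of its letters. The set \<open>all_perms\<close>
  excludes the empty permutation. List positions are 0-based, letters are 1-based.
\<close>

definition perms :: "nat \<Rightarrow> nat list set" where
  "perms n = permutations_of_set {1..n}"

definition all_perms :: "nat list set" where
  "all_perms = (\<Union>n\<in>{1..}. perms n)"

definition contains_pattern :: "nat list \<Rightarrow> nat list \<Rightarrow> bool" where
  "contains_pattern \<sigma> \<tau> \<longleftrightarrow>
     (\<exists>i. strict_mono_on {..<length \<tau>} i \<and> i ` {..<length \<tau>} \<subseteq> {..<length \<sigma>} \<and>
       (\<forall>a<length \<tau>. \<forall>b<length \<tau>. \<sigma> ! i a < \<sigma> ! i b \<longleftrightarrow> \<tau> ! a < \<tau> ! b))"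

definition avoiders_of_length :: "nat list set \<Rightarrow> nat \<Rightarrow> nat list set" where
  "avoiders_of_length B n = {\<sigma> \<in> perms n. \<forall>\<tau>\<in>B. \<not> contains_pattern \<sigma> \<tau>}"

definition avoiders :: "nat list set \<Rightarrow> nat list set" where
  "avoiders B = (\<Union>n\<in>{1..}. avoiders_of_length B n)"

definition avoiders_gf :: "nat list set \<Rightarrow> 'a::field_char_0 fps" where
  "avoiders_gf B = Abs_fps (\<lambda>n. if n = 0 then 0 else of_nat (card (avoiders_of_length B n)))"

definition tree_parent :: "nat list \<Rightarrow> nat list" where
  "tree_parent \<pi> = removeAll (length \<pi>) \<pi>"

text \<open>The pattern-avoidance tree, as the relation of its (parent, child) pairs.\<close>

definition tree_edges :: "nat list set \<Rightarrow> nat list rel" where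
  "tree_edges B = {(\<pi>, \<sigma>). \<pi> \<in> avoiders B \<and> \<sigma> \<in> avoiders B \<and> 2 \<le> length \<sigma> \<and> \<pi> = tree_parent \<sigma>}"

definition tree_children :: "nat list set \<Rightarrow> nat list \<Rightarrow> nat list set" where
  "tree_children B \<pi> = tree_edges B `` {\<pi>}"

definition subtree_nodes :: "nat list set \<Rightarrow> nat list \<Rightarrow> nat list set" where
  "subtree_nodes B \<pi> = (tree_edges B)\<^sup>* `` {\<pi>}"

text \<open>
  Isomorphism of rooted trees, each given by its node set, its relation of
  (parent, child) pairs, of which only pairs inside the node set matter, and its root.
\<close>

definition rooted_tree_iso ::
    "'a set \<Rightarrow> 'a rel \<Rightarrow> 'a \<Rightarrow> 'b set \<Rightarrow> 'b rel \<Rightarrow> 'b \<Rightarrow> bool" where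
  "rooted_tree_iso N E r N' E' r' \<longleftrightarrow>
     (\<exists>f. bij_betw f N N' \<and> f r = r' \<and> (\<forall>x\<in>N. \<forall>y\<in>N. (x, y) \<in> E \<longleftrightarrow> (f x, f y) \<in> E'))"

definition tree_equivalent :: "nat list set \<Rightarrow> nat list \<Rightarrow> nat list \<Rightarrow> bool" where
  "tree_equivalent B \<pi> \<pi>' \<longleftrightarrow> \<pi> \<in> avoiders B \<and> \<pi>' \<in> avoiders B \<and>
     rooted_tree_iso (subtree_nodes B \<pi>) (tree_edges B) \<pi> (subtree_nodes B \<pi>') (tree_edges B) \<pi>'"

text \<open>
  \<open>R\<close> is an admissible choice of class labels: one element of minimal length from each
  equivalence class. The digraph \<open>D[B]\<close> is the node set \<open>R\<close> together with the
  edge multiplicities \<open>edge_mult B v w\<close> for \<open>v\<close>, \<open>w\<close> in \<open>R\<close>.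
\<close>

definition class_representatives :: "nat list set \<Rightarrow> nat list set \<Rightarrow> bool" where
  "class_representatives B R \<longleftrightarrow> R \<subseteq> avoiders B \<and>
     (\<forall>\<pi>\<in>avoiders B. \<exists>!\<rho>. \<rho> \<in> R \<and> tree_equivalent B \<pi> \<rho>) \<and>
     (\<forall>\<rho>\<in>R. \<forall>\<pi>. tree_equivalent B \<pi> \<rho> \<longrightarrow> length \<rho> \<le> length \<pi>)"

definition edge_mult :: "nat list set \<Rightarrow> nat list \<Rightarrow> nat list \<Rightarrow> nat" where
  "edge_mult B v w = card {\<sigma> \<in> tree_children B v. tree_equivalent B \<sigma> w}"

text \<open>
  A directed multigraph is a node set \<open>V\<close> with a function \<open>E\<close> giving the number of edges
  between two nodes of \<open>V\<close>. The infinite sequence \<open>v\<close> enumerates \<open>V'\<close>; it is injective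
  because of the condition on lengths.
\<close>

definition almost_path_directed ::
    "nat list set \<Rightarrow> (nat list \<Rightarrow> nat list \<Rightarrow> nat) \<Rightarrow> (nat \<Rightarrow> nat list) \<Rightarrow> nat list set \<Rightarrow> bool" where
  "almost_path_directed V E v W \<longleftrightarrow> V \<subseteq> all_perms \<and> V = range v \<union> W \<and> range v \<inter> W = {} \<and>
     (\<exists>m\<ge>1. (\<forall>i. length (v i) = i + m) \<and> (\<forall>w\<in>W. length w \<le> m)) \<and>
     (\<forall>j. E (v j) (v (Suc j)) = 1) \<and>
     (\<forall>c\<in>V. \<forall>d\<in>V. E c d > 0 \<longrightarrow> (\<exists>j. c = v j \<and> d = v (Suc j)) \<or> c \<in> W \<or> d \<in> W)"

text \<open>
  Power series expansion at 0 of a rational function; the denominator may be taken nonzero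
  at 0, since a rational function with a power series expansion at 0 has no pole there.
\<close>

definition rational_fps :: "'a::field_char_0 fps \<Rightarrow> bool" where
  "rational_fps F \<longleftrightarrow> (\<exists>p q. poly q 0 \<noteq> 0 \<and> F = fps_of_poly p / fps_of_poly q)"

end

theory Submission
  imports Defs
begin

text \<open>
  Let \<open>H\<^sub>c\<close> count the descendants of a node \<open>c\<close> by depth, so that
  \<open>H\<^sub>c = 1 + x \<Sum>\<^sub>d M(c,d) H\<^sub>d\<close>. Along the path, iterating this equation gives
  \<open>H\<^bsub>v\<^sub>j\<^esub> = 1/(1-x) + x \<Sum>\<^bsub>w\<in>W\<^esub> A\<^bsub>w,j\<^esub> H\<^sub>w\<close>, where
  \<open>A\<^bsub>w,j\<^esub> = \<Sum>\<^sub>i M(v\<^bsub>j+i\<^esub>,w) x\<^sup>i\<close> is rational, being a shift of a rational series.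
  Substituting this into the equations of the finitely many nodes in \<open>W\<close> leaves a finite linear
  system \<open>H\<^sub>w = b\<^sub>w + x \<Sum>\<^bsub>u\<in>W\<^esub> C\<^bsub>w,u\<^esub> H\<^sub>u\<close> with rational coefficients. It is solved by
  elimination, the pivots \<open>1 - x C\<^bsub>w,w\<^esub>\<close> being invertible.
\<close>

unbundle fps_syntax

section \<open>Rational power series\<close>

text \<open>A polynomial with nonzero constant term is a unit among power series, so the division
  can be cleared. The closure lemmas work with this multiplied-out form.\<close>

lemma rational_fps_iff:
  fixes F :: "'a::field_char_0 fps"
  shows "rational_fps F \<longleftrightarrow>
    (\<exists>p q. poly q 0 \<noteq> 0 \<and> F * fps_of_poly q = fps_of_poly p)"
proof -
  have "F = fps_of_poly p / fps_of_poly q \<longleftrightarrow> F * fps_of_poly q = fps_of_poly p"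
    if "poly q 0 \<noteq> 0" for p q :: "'a poly"
  proof -
    have "fps_of_poly q $ 0 \<noteq> 0" using that by (simp add: poly_0_coeff_0)
    then have "is_unit (fps_of_poly q)" by simp
    then show ?thesis
      by (metis dvd_div_mult_self dvd_trans nonzero_mult_div_cancel_right not_is_unit_0 one_dvd)
  qed
  then show ?thesis unfolding rational_fps_def by blast
qed

section \<open>Closure of rational series under arithmetic, inversion and shift\<close>

lemma rational_fps_of_poly: "rational_fps (fps_of_poly p)"
  unfolding rational_fps_iff by (rule exI[of _ p], rule exI[of _ 1]) simp

lemma rational_fps_0 [simp]: "rational_fps 0"
  using rational_fps_of_poly[of 0] by simp

lemma rational_fps_1 [simp]: "rational_fps 1"
  using rational_fps_of_poly[of 1] by simp

lemma rational_fps_X [simp]: "rational_fps fps_X"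
  using rational_fps_of_poly[of "[:0, 1:]"] by (simp add: fps_of_poly_pCons)

lemma rational_fps_const [simp]: "rational_fps (fps_const c)"
  using rational_fps_of_poly[of "[:c:]"] by (simp add: fps_of_poly_pCons)

lemma rational_fps_of_nat [simp]: "rational_fps (of_nat n)"
  by (metis fps_of_nat rational_fps_const)

lemma rational_fps_add:
  fixes F G :: "'a::field_char_0 fps"
  assumes "rational_fps F" "rational_fps G"
  shows "rational_fps (F + G)"
proof -
  obtain p q r s where "poly q 0 \<noteq> 0" "F * fps_of_poly q = fps_of_poly p"
    "poly s 0 \<noteq> 0" "G * fps_of_poly s = fps_of_poly r"
    using assms unfolding rational_fps_iff by blast
  moreover have "(F + G) * (fps_of_poly q * fps_of_poly s) =
      (F * fps_of_poly q) * fps_of_poly s + (G * fps_of_poly s) * fps_of_poly q"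
    by (simp add: algebra_simps)
  ultimately show ?thesis unfolding rational_fps_iff
    by (intro exI[of _ "p * s + r * q"] exI[of _ "q * s"])
      (simp add: fps_of_poly_mult fps_of_poly_add)
qed

lemma rational_fps_mult:
  fixes F G :: "'a::field_char_0 fps"
  assumes "rational_fps F" "rational_fps G"
  shows "rational_fps (F * G)"
proof -
  obtain p q r s where "poly q 0 \<noteq> 0" "F * fps_of_poly q = fps_of_poly p"
    "poly s 0 \<noteq> 0" "G * fps_of_poly s = fps_of_poly r"
    using assms unfolding rational_fps_iff by blast
  moreover have "(F * G) * (fps_of_poly q * fps_of_poly s) =
      (F * fps_of_poly q) * (G * fps_of_poly s)"
    by (simp add: algebra_simps)
  ultimately show ?thesis unfolding rational_fps_iff
    by (intro exI[of _ "p * r"] exI[of _ "q * s"]) (simp add: fps_of_poly_mult)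
qed

lemma rational_fps_sum:
  assumes "\<And>x. x \<in> A \<Longrightarrow> rational_fps (f x)"
  shows "rational_fps (sum f A)"
  using assms by (induction A rule: infinite_finite_induct) (auto intro: rational_fps_add)

lemma rational_fps_uminus: "rational_fps F \<Longrightarrow> rational_fps (- F)"
  using rational_fps_mult[OF rational_fps_const[of "-1"], of F]
  by (simp add: fps_const_neg[symmetric] del: fps_const_neg)

lemma rational_fps_diff: "rational_fps F \<Longrightarrow> rational_fps G \<Longrightarrow> rational_fps (F - G)"
  using rational_fps_add[of F "- G"] rational_fps_uminus[of G] by simp

text \<open>Numerator and denominator change places. The condition on \<open>F $ 0\<close> keeps the
  new denominator nonzero at 0.\<close>

lemma rational_fps_inverse:
  fixes F :: "'a::field_char_0 fps"
  assumes "rational_fps F" "F $ 0 \<noteq> 0"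
  shows "rational_fps (inverse F)"
proof -
  obtain p q where q: "poly q 0 \<noteq> 0" and p: "F * fps_of_poly q = fps_of_poly p"
    using assms unfolding rational_fps_iff by blast
  have "poly p 0 = F $ 0 * poly q 0"
    using arg_cong[OF p, of "\<lambda>G. G $ 0"] by (simp add: poly_0_coeff_0)
  moreover have "inverse F * fps_of_poly p = fps_of_poly q"
    using assms(2) by (simp add: p[symmetric] mult.assoc[symmetric] inverse_mult_eq_1)
  ultimately show ?thesis
    unfolding rational_fps_iff using assms(2) q by (intro exI[of _ q] exI[of _ p]) simp
qed

text \<open>From \<open>F = F $ 0 + x * F'\<close> and \<open>F * q = p\<close> follows
  \<open>x * F' * q = p - F $ 0 * q\<close>. The right-hand side has zero constant term, so a factor
  \<open>x\<close> cancels and the denominator \<open>q\<close> is kept.\<close>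

lemma rational_fps_shift_1:
  fixes F :: "'a::field_char_0 fps"
  assumes "rational_fps F"
  shows "rational_fps (fps_shift 1 F)"
proof -
  obtain p q where q: "poly q 0 \<noteq> 0" and p: "F * fps_of_poly q = fps_of_poly p"
    using assms unfolding rational_fps_iff by blast
  define r where "r = p - smult (F $ 0) q"
  have "coeff r 0 = 0"
    using arg_cong[OF p, of "\<lambda>G. G $ 0"] by (simp add: r_def)
  then obtain s where s: "r = pCons 0 s"
    by (cases r) auto
  have F: "F = fps_const (F $ 0) + fps_X * fps_shift 1 F"
    by (rule fps_ext) (auto simp: fps_X_mult_nth)
  have "fps_X * (fps_shift 1 F * fps_of_poly q) = (F - fps_const (F $ 0)) * fps_of_poly q"
    by (subst (2) F) (simp add: algebra_simps)
  also have "\<dots> = fps_of_poly r"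
    by (simp add: r_def p fps_of_poly_diff fps_of_poly_smult left_diff_distrib)
  also have "\<dots> = fps_X * fps_of_poly s"
    by (simp add: s fps_of_poly_pCons mult.commute)
  finally have "fps_shift 1 F * fps_of_poly q = fps_of_poly s" by simp
  then show ?thesis unfolding rational_fps_iff using q by blast
qed

lemma rational_fps_shift:
  assumes "rational_fps F"
  shows "rational_fps (fps_shift n F)"
proof (induction n)
  case (Suc n)
  have "fps_shift (Suc n) F = fps_shift 1 (fps_shift n F)"
    by (rule fps_ext) simp
  with Suc show ?case by (simp only: rational_fps_shift_1)
qed (simp add: assms)

lemmas rational_fps_intros =
  rational_fps_add rational_fps_mult rational_fps_sum rational_fps_0 rational_fps_1
  rational_fps_X rational_fps_of_nat

text \<open>Gaussian elimination by induction on the index set. The factor \<open>fps_X\<close>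
  gives each pivot the constant term 1, and it survives the substitution, so the reduced system has
  the same shape. Its coefficients differ, hence the induction is general in \<open>b\<close> and
  \<open>C\<close>.\<close>

lemma rational_fps_linear_system:
  fixes F :: "'i \<Rightarrow> 'a::field_char_0 fps"
  assumes "finite I"
    and "\<And>i. i \<in> I \<Longrightarrow> rational_fps (b i)"
    and "\<And>i j. i \<in> I \<Longrightarrow> j \<in> I \<Longrightarrow> rational_fps (C i j)"
    and "\<And>i. i \<in> I \<Longrightarrow> F i = b i + fps_X * (\<Sum>j\<in>I. C i j * F j)"
    and "i \<in> I"
  shows "rational_fps (F i)"
  using assms
proof (induction I arbitrary: b C i rule: finite_induct)
  case (insert a I)
  define u where "u = inverse (1 - fps_X * C a a)"
  have u: "u * (1 - fps_X * C a a) = 1"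
    unfolding u_def by (rule inverse_mult_eq_1) simp
  have rat_u: "rational_fps u"
    unfolding u_def by (intro rational_fps_inverse rational_fps_diff rational_fps_intros insert) auto
  have "(1 - fps_X * C a a) * F a = b a + fps_X * (\<Sum>j\<in>I. C a j * F j)"
    using insert.prems(3)[of a] insert.hyps by (simp add: algebra_simps)
  then have "u * ((1 - fps_X * C a a) * F a) = u * (b a + fps_X * (\<Sum>j\<in>I. C a j * F j))"
    by simp
  then have Fa: "F a = u * (b a + fps_X * (\<Sum>j\<in>I. C a j * F j))"
    by (simp add: mult.assoc[symmetric] u)
  have rat_I: "rational_fps (F i)" if "i \<in> I" for i
  \<comment> \<open>These are the coefficients left after the solved form \<open>Fa\<close> is
    substituted into the equation of \<open>i\<close>.\<close>
  proof (rule insert.IH[where b = "\<lambda>i. b i + fps_X * C i a * u * b a"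
        and C = "\<lambda>i j. C i j + fps_X * C i a * u * C a j"])
    fix i assume i: "i \<in> I"
    have "F i = b i + fps_X * (C i a * F a + (\<Sum>j\<in>I. C i j * F j))"
      using insert.prems(3)[of i] insert.hyps i by simp
    also have "\<dots> = b i + fps_X * C i a * u * b a +
        fps_X * ((\<Sum>j\<in>I. C i j * F j) + fps_X * C i a * u * (\<Sum>j\<in>I. C a j * F j))"
      by (simp add: Fa algebra_simps)
    also have "(\<Sum>j\<in>I. C i j * F j) + fps_X * C i a * u * (\<Sum>j\<in>I. C a j * F j) =
        (\<Sum>j\<in>I. (C i j + fps_X * C i a * u * C a j) * F j)"
      by (simp add: sum_distrib_left distrib_right sum.distrib mult.assoc)
    finally show "F i = b i + fps_X * C i a * u * b a +
        fps_X * (\<Sum>j\<in>I. (C i j + fps_X * C i a * u * C a j) * F j)" .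
  qed (use that in \<open>auto intro!: rational_fps_intros rat_u insert.prems\<close>)
  have "rational_fps (F a)"
    by (subst Fa) (auto intro!: rational_fps_intros rat_u rat_I insert.prems)
  with rat_I show ?case using insert.prems(4) by auto
qed simp

section \<open>Levels of the pattern-avoidance tree\<close>

lemma permsD:
  assumes "\<sigma> \<in> perms n"
  shows "length \<sigma> = n" "distinct \<sigma>" "set \<sigma> = {1..n}"
  using assms unfolding perms_def
  by (auto simp: permutations_of_set_def distinct_card[symmetric])

lemma finite_perms: "finite (perms n)"
  unfolding perms_def by simp

lemma avoiders_of_length_length: "\<sigma> \<in> avoiders_of_length B n \<Longrightarrow> length \<sigma> = n"
  unfolding avoiders_of_length_def by (auto dest: permsD)

lemma avoiders_iff:
  "\<sigma> \<in> avoiders B \<longleftrightarrow> 1 \<le> length \<sigma> \<and> \<sigma> \<in> avoiders_of_length B (length \<sigma>)"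
  unfolding avoiders_def by (auto dest: avoiders_of_length_length)

lemma finite_avoiders_of_length: "finite (avoiders_of_length B n)"
  unfolding avoiders_of_length_def by (rule finite_subset[OF _ finite_perms[of n]]) auto

text \<open>An occurrence is carried along the increasing map \<open>g\<close> of positions that
  skips the place of \<open>x\<close>. Read contrapositively, deleting a letter preserves
  avoidance.\<close>

lemma contains_pattern_insert:
  assumes "contains_pattern (as @ bs) \<tau>"
  shows "contains_pattern (as @ x # bs) \<tau>"
proof -
  obtain i where i: "strict_mono_on {..<length \<tau>} i"
    "i ` {..<length \<tau>} \<subseteq> {..<length (as @ bs)}"
    "\<And>a b. a < length \<tau> \<Longrightarrow> b < length \<tau> \<Longrightarrow>
      (as @ bs) ! i a < (as @ bs) ! i b \<longleftrightarrow> \<tau> ! a < \<tau> ! b"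
    using assms unfolding contains_pattern_def by blast
  define g where "g k = (if k < length as then k else Suc k)" for k
  have g: "(as @ x # bs) ! g k = (as @ bs) ! k" for k
    by (auto simp: g_def nth_append Suc_diff_le)
  have "strict_mono g"
    by (auto simp: strict_mono_def g_def)
  then have "strict_mono_on {..<length \<tau>} (g \<circ> i)"
    using i(1) by (auto simp: strict_mono_on_def strict_mono_def)
  moreover have "(g \<circ> i) ` {..<length \<tau>} \<subseteq> {..<length (as @ x # bs)}"
    using i(2) by (fastforce simp: g_def)
  ultimately show ?thesis
    unfolding contains_pattern_def using i(3) by (intro exI[of _ "g \<circ> i"]) (simp add: g)
qed

lemma tree_parent_avoiders_of_length:
  assumes "\<sigma> \<in> avoiders_of_length B (Suc n)"
  shows "tree_parent \<sigma> \<in> avoiders_of_length B n"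
proof -
  have \<sigma>: "length \<sigma> = Suc n" "distinct \<sigma>" "set \<sigma> = {1..Suc n}"
    using assms unfolding avoiders_of_length_def by (auto dest: permsD)
  then obtain as bs where split: "\<sigma> = as @ Suc n # bs"
    by (metis atLeastAtMost_iff le_add1 order_refl plus_1_eq_Suc split_list)
  have parent: "tree_parent \<sigma> = as @ bs"
    using \<sigma>(1,2) unfolding tree_parent_def by (auto simp: split removeAll_id)
  have "set (as @ bs) = set \<sigma> - {Suc n}" using \<sigma>(2) by (auto simp: split)
  also have "\<dots> = {1..n}" unfolding \<sigma>(3) by (simp add: atLeastAtMostSuc_conv)
  finally have "as @ bs \<in> perms n"
    using \<sigma>(2) unfolding perms_def permutations_of_set_def by (auto simp: split)
  then show ?thesis
    using assms contains_pattern_insert[of as bs _ "Suc n"]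
    unfolding parent avoiders_of_length_def by (auto simp: split)
qed

text \<open>A parent inherits avoidance from its child, so membership is checked for the child
  alone. The condition that the parent is nonempty replaces the bound 2 on the child's length and
  keeps the empty word from being the parent of \<open>[1]\<close>.\<close>

lemma tree_edges_iff:
  "(\<pi>, \<sigma>) \<in> tree_edges B \<longleftrightarrow>
    \<pi> \<noteq> [] \<and> \<sigma> \<in> avoiders_of_length B (Suc (length \<pi>)) \<and> \<pi> = tree_parent \<sigma>"
proof
  assume "(\<pi>, \<sigma>) \<in> tree_edges B"
  then have \<sigma>: "\<pi> \<in> avoiders B" "\<sigma> \<in> avoiders_of_length B (length \<sigma>)" "2 \<le> length \<sigma>" "\<pi> = tree_parent \<sigma>"
    unfolding tree_edges_def avoiders_iff by auto
  then obtain n where n: "length \<sigma> = Suc n" by (cases "length \<sigma>") auto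
  have "length \<pi> = n"
    using \<sigma> tree_parent_avoiders_of_length[of \<sigma> B n] avoiders_of_length_length n by metis
  then show "\<pi> \<noteq> [] \<and> \<sigma> \<in> avoiders_of_length B (Suc (length \<pi>)) \<and> \<pi> = tree_parent \<sigma>"
    using \<sigma> n by auto
next
  assume *: "\<pi> \<noteq> [] \<and> \<sigma> \<in> avoiders_of_length B (Suc (length \<pi>)) \<and> \<pi> = tree_parent \<sigma>"
  then have "\<pi> \<in> avoiders_of_length B (length \<pi>)" "length \<sigma> = Suc (length \<pi>)"
    "\<sigma> \<in> avoiders_of_length B (Suc (length \<pi>))"
    using tree_parent_avoiders_of_length avoiders_of_length_length by metis+
  moreover have "1 \<le> length \<pi>"
    using * by (metis One_nat_def Suc_leI length_greater_0_conv)
  ultimately have "\<pi> \<in> avoiders B" "\<sigma> \<in> avoiders B" "2 \<le> length \<sigma>"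
    by (simp_all add: avoiders_iff)
  with * show "(\<pi>, \<sigma>) \<in> tree_edges B"
    unfolding tree_edges_def by blast
qed

section \<open>Generations of descendants and their sizes\<close>

definition tree_level :: "nat list set \<Rightarrow> nat list \<Rightarrow> nat \<Rightarrow> nat list set" where
  "tree_level B \<pi> k = (tree_edges B ^^ k) `` {\<pi>}"

lemma tree_level_0 [simp]: "tree_level B \<pi> 0 = {\<pi>}"
  by (auto simp: tree_level_def)

text \<open>Splitting off the first step gives the recursion for the counts; the companion
  \<open>tree_level_Suc'\<close> splits off the last step and serves inductions that descend through
  the tree.\<close>

lemma tree_level_Suc: "tree_level B \<pi> (Suc k) = (\<Union>\<sigma>\<in>tree_children B \<pi>. tree_level B \<sigma> k)"
  unfolding tree_level_def tree_children_def by (auto simp: relpow_commute[symmetric])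

lemma tree_level_Suc': "tree_level B \<pi> (Suc k) = tree_edges B `` tree_level B \<pi> k"
  unfolding tree_level_def by auto

lemma tree_children_subset: "tree_children B \<pi> \<subseteq> avoiders_of_length B (Suc (length \<pi>))"
  unfolding tree_children_def by (auto simp: tree_edges_iff)

lemma finite_tree_children: "finite (tree_children B \<pi>)"
  by (rule finite_subset[OF tree_children_subset finite_avoiders_of_length])

lemma tree_children_avoiders: "tree_children B \<pi> \<subseteq> avoiders B"
  unfolding tree_children_def tree_edges_def by auto

lemma finite_tree_level: "finite (tree_level B \<pi> k)"
  by (induction k arbitrary: \<pi>) (auto simp: tree_level_Suc finite_tree_children)

text \<open>An edge determines its upper end as \<open>tree_parent\<close> of the lower end, so
  going up \<open>k\<close> steps can reach only one node.\<close>

lemma tree_level_disjoint: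
  assumes "\<rho> \<in> tree_level B \<pi> k" "\<rho> \<in> tree_level B \<sigma> k"
  shows "\<pi> = \<sigma>"
  using assms
proof (induction k arbitrary: \<rho>)
  case (Suc k)
  then show ?case by (auto simp: tree_level_Suc' tree_edges_iff)
qed simp

lemma card_tree_level_Suc:
  "card (tree_level B \<pi> (Suc k)) = (\<Sum>\<sigma>\<in>tree_children B \<pi>. card (tree_level B \<sigma> k))"
  unfolding tree_level_Suc
  by (rule card_UN_disjoint)
    (auto simp: finite_tree_children finite_tree_level dest: tree_level_disjoint)

section \<open>Invariance of generation sizes under tree isomorphism\<close>

lemma rooted_tree_iso_sym:
  assumes "rooted_tree_iso N E r N' E' r'" "r \<in> N"
  shows "rooted_tree_iso N' E' r' N E r"
proof -
  obtain f where f: "bij_betw f N N'" "f r = r'"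
    "\<And>x y. x \<in> N \<Longrightarrow> y \<in> N \<Longrightarrow> (x, y) \<in> E \<longleftrightarrow> (f x, f y) \<in> E'"
    using assms(1) unfolding rooted_tree_iso_def by blast
  define g where "g = inv_into N f"
  have g: "bij_betw g N' N" "g r' = r" "\<And>y. y \<in> N' \<Longrightarrow> g y \<in> N \<and> f (g y) = y"
    unfolding g_def using f assms(2) bij_betw_inv_into[OF f(1)]
    by (auto simp: bij_betw_inv_into_left bij_betw_inv_into_right bij_betw_apply)
  then show ?thesis
    unfolding rooted_tree_iso_def using f(3) by (intro exI[of _ g]) auto
qed

lemma tree_equivalent_sym: "tree_equivalent B \<pi> \<pi>' \<Longrightarrow> tree_equivalent B \<pi>' \<pi>"
  unfolding tree_equivalent_def by (auto simp: subtree_nodes_def intro: rooted_tree_iso_sym)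

lemma tree_level_subset: "tree_level B \<pi> k \<subseteq> subtree_nodes B \<pi>"
  unfolding tree_level_def subtree_nodes_def by (auto intro: relpow_imp_rtrancl)

text \<open>An isomorphism fixes the depth of a node: it maps root to root and edges to edges, hence
  generation \<open>k\<close> injectively into generation \<open>k\<close>. Symmetry of the
  equivalence then turns the inequality into equality.\<close>

lemma tree_equivalent_card_le:
  assumes "tree_equivalent B \<pi> \<pi>'"
  shows "card (tree_level B \<pi> k) \<le> card (tree_level B \<pi>' k)"
proof -
  let ?N = "subtree_nodes B \<pi>"
  obtain f where f: "bij_betw f ?N (subtree_nodes B \<pi>')" "f \<pi> = \<pi>'"
    "\<And>x y. x \<in> ?N \<Longrightarrow> y \<in> ?N \<Longrightarrow> (x, y) \<in> tree_edges B \<longleftrightarrow> (f x, f y) \<in> tree_edges B"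
    using assms unfolding tree_equivalent_def rooted_tree_iso_def by blast
  have "f \<sigma> \<in> tree_level B \<pi>' k" if "\<sigma> \<in> tree_level B \<pi> k" for \<sigma>
    using that
  proof (induction k arbitrary: \<sigma>)
    case (Suc k)
    then obtain \<rho> where \<rho>: "\<rho> \<in> tree_level B \<pi> k" "(\<rho>, \<sigma>) \<in> tree_edges B"
      by (auto simp: tree_level_Suc')
    have "(f \<rho>, f \<sigma>) \<in> tree_edges B"
      using f(3)[of \<rho> \<sigma>] \<rho> Suc.prems tree_level_subset by blast
    with Suc.IH[OF \<rho>(1)] show ?case by (auto simp: tree_level_Suc')
  qed (simp add: f)
  moreover have "inj_on f (tree_level B \<pi> k)"
    using f(1) tree_level_subset unfolding bij_betw_def by (rule inj_on_subset[OF conjunct1])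
  ultimately show ?thesis
    by (intro card_inj_on_le[of f] finite_tree_level) auto
qed

lemma tree_equivalent_card:
  "tree_equivalent B \<pi> \<pi>' \<Longrightarrow> card (tree_level B \<pi> k) = card (tree_level B \<pi>' k)"
  using tree_equivalent_card_le tree_equivalent_sym by (metis antisym)

text \<open>The root has length 1, so depth \<open>k\<close> is length \<open>k + 1\<close>. In the
  base case a pattern contained in \<open>[1]\<close> has length at most 1; patterns in
  \<open>B\<close> are nonempty permutations, so it would be \<open>[1]\<close> itself. In the step
  each longer avoider is reached from its own parent.\<close>

lemma tree_level_root:
  assumes "B \<subseteq> all_perms" "[1] \<notin> B"
  shows "tree_level B [1] k = avoiders_of_length B (Suc k)"
proof (induction k)
  case 0
  have "\<not> contains_pattern [1] \<tau>" if "\<tau> \<in> B" for \<tau>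
  proof
    assume "contains_pattern [1] \<tau>"
    then obtain i where i: "strict_mono_on {..<length \<tau>} i" "i ` {..<length \<tau>} \<subseteq> {..<Suc 0}"
      unfolding contains_pattern_def by auto
    have "length \<tau> \<le> 1"
      using card_inj_on_le[OF strict_mono_on_imp_inj_on[OF i(1)] i(2)] by simp
    moreover obtain n where "n \<ge> 1" "\<tau> \<in> perms n"
      using \<open>\<tau> \<in> B\<close> assms(1) unfolding all_perms_def by auto
    ultimately have "\<tau> \<in> perms 1" by (metis le_antisym permsD(1))
    then have "\<tau> = [1]" by (simp add: perms_def)
    with \<open>\<tau> \<in> B\<close> assms(2) show False by simp
  qed
  then show ?case by (auto simp: avoiders_of_length_def perms_def)
next
  case (Suc k)
  have "tree_edges B `` avoiders_of_length B (Suc k) = avoiders_of_length B (Suc (Suc k))"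
  proof (intro equalityI subsetI)
    fix \<sigma> assume \<sigma>: "\<sigma> \<in> avoiders_of_length B (Suc (Suc k))"
    then have parent: "tree_parent \<sigma> \<in> avoiders_of_length B (Suc k)"
      by (rule tree_parent_avoiders_of_length)
    then have "length (tree_parent \<sigma>) = Suc k" by (rule avoiders_of_length_length)
    with \<sigma> have "(tree_parent \<sigma>, \<sigma>) \<in> tree_edges B" by (auto simp: tree_edges_iff)
    with parent show "\<sigma> \<in> tree_edges B `` avoiders_of_length B (Suc k)" by blast
  qed (auto simp: tree_edges_iff dest: avoiders_of_length_length)
  then show ?case unfolding tree_level_Suc' Suc .
qed

section \<open>The linear equations of the digraph\<close>

text \<open>Indexing by depth below \<open>\<pi>\<close> instead of by length makes the series the
  same for equivalent nodes of different lengths.\<close>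

definition level_gf :: "nat list set \<Rightarrow> nat list \<Rightarrow> 'a::field_char_0 fps" where
  "level_gf B \<pi> = Abs_fps (\<lambda>k. of_nat (card (tree_level B \<pi> k)))"

lemma avoiders_gf_eq_level_gf:
  assumes "B \<subseteq> all_perms" "[1] \<notin> B"
  shows "(avoiders_gf B :: 'a::field_char_0 fps) = fps_X * level_gf B [1]"
  unfolding avoiders_gf_def level_gf_def tree_level_root[OF assms]
  by (rule fps_ext) (auto simp: fps_X_mult_nth)

lemma tree_equivalent_level_gf:
  "tree_equivalent B \<pi> \<pi>' \<Longrightarrow> level_gf B \<pi> = level_gf B \<pi>'"
  unfolding level_gf_def by (simp add: tree_equivalent_card)

lemma level_gf_children:
  "(level_gf B \<pi> :: 'a::field_char_0 fps) =
    1 + fps_X * (\<Sum>\<sigma>\<in>tree_children B \<pi>. level_gf B \<sigma>)"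
proof (rule fps_ext)
  fix n
  show "(level_gf B \<pi> :: 'a fps) $ n =
      (1 + fps_X * (\<Sum>\<sigma>\<in>tree_children B \<pi>. level_gf B \<sigma>)) $ n"
    by (cases n) (simp_all add: level_gf_def fps_sum_nth card_tree_level_Suc)
qed

text \<open>Each out-neighbour is the unique representative of some child, and a node has finitely
  many children. This makes the sum over out-neighbours meaningful even when \<open>R\<close> is
  infinite.\<close>

lemma finite_out_neighbours:
  assumes "class_representatives B R"
  shows "finite {d \<in> R. edge_mult B c d > 0}"
proof -
  have "{d \<in> R. edge_mult B c d > 0} \<subseteq>
      (\<lambda>\<sigma>. THE d. d \<in> R \<and> tree_equivalent B \<sigma> d) ` tree_children B c"
  proof
    fix d assume "d \<in> {d \<in> R. edge_mult B c d > 0}"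
    then obtain \<sigma> where \<sigma>: "\<sigma> \<in> tree_children B c" "tree_equivalent B \<sigma> d" "d \<in> R"
      unfolding edge_mult_def card_gt_0_iff by blast
    then have "\<exists>!d. d \<in> R \<and> tree_equivalent B \<sigma> d"
      using assms tree_children_avoiders unfolding class_representatives_def by blast
    then have "d = (THE d. d \<in> R \<and> tree_equivalent B \<sigma> d)"
      using \<sigma> by (intro the1_equality[symmetric]) auto
    with \<sigma>(1) show "d \<in> (\<lambda>\<sigma>. THE d. d \<in> R \<and> tree_equivalent B \<sigma> d) ` tree_children B c"
      by blast
  qed
  then show ?thesis by (rule finite_subset) (simp add: finite_tree_children)
qed

text \<open>The children are grouped by equivalence class, and equivalent children contribute equal
  series. \<open>S\<close> may be any finite set of representatives containing the out-neighbours,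
  which suits both path nodes and the general case.\<close>

lemma level_gf_digraph:
  fixes B R
  assumes R: "class_representatives B R"
    and S: "finite S" "S \<subseteq> R" "{d \<in> R. edge_mult B c d > 0} \<subseteq> S"
  shows "(level_gf B c :: 'a::field_char_0 fps) =
    1 + fps_X * (\<Sum>d\<in>S. of_nat (edge_mult B c d) * level_gf B d)"
proof -
  define K where "K d = {\<sigma> \<in> tree_children B c. tree_equivalent B \<sigma> d}" for d
  have uniq: "\<exists>!d. d \<in> R \<and> tree_equivalent B \<sigma> d" if "\<sigma> \<in> tree_children B c" for \<sigma>
    using R that tree_children_avoiders unfolding class_representatives_def by blast
  have fin: "finite (K d)" for d
    unfolding K_def using finite_tree_children by simp
  have disj: "K d \<inter> K e = {}" if "d \<in> S" "e \<in> S" "d \<noteq> e" for d e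
    using that S(2) uniq unfolding K_def by blast
  have children: "tree_children B c = (\<Union>d\<in>S. K d)"
  proof (intro equalityI subsetI)
    fix \<sigma> assume \<sigma>: "\<sigma> \<in> tree_children B c"
    then obtain d where d: "d \<in> R" "tree_equivalent B \<sigma> d" using uniq by blast
    then have "edge_mult B c d > 0"
      using \<sigma> fin[of d] unfolding edge_mult_def K_def card_gt_0_iff by blast
    with d \<sigma> S(3) show "\<sigma> \<in> (\<Union>d\<in>S. K d)" unfolding K_def by blast
  qed (auto simp: K_def)
  have "(\<Sum>\<sigma>\<in>tree_children B c. level_gf B \<sigma> :: 'a fps) = (\<Sum>d\<in>S. \<Sum>\<sigma>\<in>K d. level_gf B \<sigma>)"
    unfolding children using S(1) fin disj by (intro sum.UNION_disjoint) auto
  also have "\<dots> = (\<Sum>d\<in>S. of_nat (edge_mult B c d) * level_gf B d)"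
  proof (rule sum.cong[OF refl])
    fix d
    have "(\<Sum>\<sigma>\<in>K d. level_gf B \<sigma> :: 'a fps) = (\<Sum>\<sigma>\<in>K d. level_gf B d)"
      by (rule sum.cong) (auto simp: K_def dest: tree_equivalent_level_gf)
    then show "(\<Sum>\<sigma>\<in>K d. level_gf B \<sigma> :: 'a fps) = of_nat (edge_mult B c d) * level_gf B d"
      by (simp add: K_def edge_mult_def)
  qed
  finally show ?thesis by (subst level_gf_children) simp
qed

section \<open>Solving the infinite recursion along the path\<close>

text \<open>Coefficient \<open>n + 1\<close> of \<open>D j\<close> is coefficient \<open>n\<close>
  of \<open>D (j + 1)\<close>, and constant terms vanish. This gives uniqueness for the recursion
  along the path without a limit argument.\<close>

lemma fps_eq_0_if_X_chain:
  fixes D :: "nat \<Rightarrow> 'a::comm_ring_1 fps"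
  assumes "\<And>j. D j = fps_X * D (Suc j)"
  shows "D j = 0"
proof (rule fps_ext)
  fix n
  show "D j $ n = 0 $ n"
  proof (induction n arbitrary: j)
    case 0
    show ?case by (subst assms) simp
  next
    case (Suc n)
    show ?case using Suc[of "Suc j"] by (subst assms) simp
  qed
qed

text \<open>Both sides satisfy the same recursion in \<open>j\<close>, so their difference is an
  \<open>fps_X\<close> chain and vanishes.\<close>

lemma level_gf_path:
  fixes B R W v
  assumes R: "class_representatives B R"
    and G: "almost_path_directed R (edge_mult B) v W"
    and W: "finite W"
  shows "(level_gf B (v j) :: 'a::field_char_0 fps) = inverse (1 - fps_X) +
    fps_X * (\<Sum>w\<in>W. fps_shift j (Abs_fps (\<lambda>i. of_nat (edge_mult B (v i) w))) * level_gf B w)"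
proof -
  define A where "A j w = fps_shift j (Abs_fps (\<lambda>i. of_nat (edge_mult B (v i) w)) :: 'a fps)" for j w
  define K where "K j = inverse (1 - fps_X) + fps_X * (\<Sum>w\<in>W. A j w * level_gf B w)" for j
  have A: "A j w = of_nat (edge_mult B (v j) w) + fps_X * A (Suc j) w" for j w
    unfolding A_def fps_of_nat[symmetric]
    by (rule fps_ext) (auto simp: fps_X_mult_nth)
  \<comment> \<open>The geometric series counts the path nodes from \<open>v j\<close> onwards, one
    at each depth.\<close>
  have geo: "inverse (1 - fps_X) = (1 + fps_X * inverse (1 - fps_X) :: 'a fps)"
    using inverse_mult_eq_1'[of "1 - fps_X :: 'a fps"] by (simp add: algebra_simps)
  have K: "K j = 1 + fps_X * (K (Suc j) + (\<Sum>w\<in>W. of_nat (edge_mult B (v j) w) * level_gf B w))" for j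
  proof -
    have "(\<Sum>w\<in>W. A j w * level_gf B w) = (\<Sum>w\<in>W. of_nat (edge_mult B (v j) w) * level_gf B w) +
        fps_X * (\<Sum>w\<in>W. A (Suc j) w * level_gf B w)"
      by (subst A) (simp add: distrib_right sum.distrib sum_distrib_left mult.assoc)
    then show ?thesis
      unfolding K_def by (subst geo) (simp add: algebra_simps)
  qed
  have H: "(level_gf B (v j) :: 'a fps) = 1 + fps_X * (level_gf B (v (Suc j)) +
      (\<Sum>w\<in>W. of_nat (edge_mult B (v j) w) * level_gf B w))" for j
  proof -
    have V: "R = range v \<union> W" "range v \<inter> W = {}" "edge_mult B (v j) (v (Suc j)) = 1"
      using G unfolding almost_path_directed_def by auto
    have "inj v"
      using G unfolding almost_path_directed_def inj_def by (metis add_right_cancel)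
    \<comment> \<open>Since \<open>v j\<close> is outside \<open>W\<close>, an edge from it ends in
      \<open>W\<close> or is a path edge; injectivity of \<open>v\<close> makes that path edge the
      one with index \<open>j\<close>.\<close>
    then have "{d \<in> R. edge_mult B (v j) d > 0} \<subseteq> insert (v (Suc j)) W"
      using G V(1,2) unfolding almost_path_directed_def inj_def by blast
    moreover have "v (Suc j) \<notin> W" using V(2) by blast
    ultimately show ?thesis
      using level_gf_digraph[OF R, of "insert (v (Suc j)) W" "v j"] V W by simp
  qed
  have "level_gf B (v j) - K j = 0"
  proof (rule fps_eq_0_if_X_chain[of "\<lambda>j. level_gf B (v j) - K j"])
    show "level_gf B (v j) - K j = fps_X * (level_gf B (v (Suc j)) - K (Suc j))" for j
      by (subst H, subst K) (simp add: algebra_simps)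
  qed
  then show ?thesis unfolding K_def A_def by simp
qed

section \<open>Reduction to the finite system on \<open>W\<close>\<close>

theorem theorem6:
  fixes B R W :: "nat list set" and v :: "nat \<Rightarrow> nat list"
  assumes "B \<subseteq> all_perms" and "[1] \<notin> B"
    and "class_representatives B R"
    and "almost_path_directed R (edge_mult B) v W"
    and "\<And>w. w \<in> W \<Longrightarrow>
      rational_fps (Abs_fps (\<lambda>j. of_nat (edge_mult B (v j) w)) :: 'a::field_char_0 fps)"
  shows "rational_fps (avoiders_gf B :: 'a fps)"
proof -
  let ?H = "level_gf B :: nat list \<Rightarrow> 'a fps"
  obtain m where "R = range v \<union> W" and m: "\<forall>w\<in>W. length w \<le> m"
    using assms(4) unfolding almost_path_directed_def by auto
  have W: "finite W"
  proof (rule finite_subset)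
    \<comment> \<open>The length bound \<open>m\<close> leaves finitely many candidates.\<close>
    show "W \<subseteq> (\<Union>n\<le>m. avoiders_of_length B n)"
      using m assms(3) \<open>R = _\<close> unfolding class_representatives_def
      by (fastforce simp: avoiders_iff)
  qed (simp add: finite_avoiders_of_length)
  \<comment> \<open>Every node's series is affine in those of \<open>W\<close> with rational
    coefficients: trivially for a node of \<open>W\<close>, by the path formula otherwise.\<close>
  have ex: "\<exists>b g. rational_fps b \<and> (\<forall>w\<in>W. rational_fps (g w)) \<and> ?H d = b + (\<Sum>w\<in>W. g w * ?H w)"
    if d: "d \<in> R" for d
  proof (cases "d \<in> W")
    case True
    have "(\<Sum>w\<in>W. (if w = d then 1 else 0) * ?H w) = (\<Sum>w\<in>W. if w = d then ?H w else 0)"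
      by (rule sum.cong) auto
    also have "\<dots> = ?H d" using True W by simp
    finally show ?thesis
      by (intro exI[of _ 0] exI[of _ "\<lambda>w. if w = d then 1 else 0"]) simp
  next
    case False
    then obtain j where j: "d = v j" using d \<open>R = _\<close> by blast
    have "rational_fps (inverse (1 - fps_X) :: 'a fps)"
      by (intro rational_fps_inverse rational_fps_diff) auto
    then show ?thesis
      unfolding j level_gf_path[OF assms(3,4) W, of j] sum_distrib_left mult.assoc[symmetric]
      by (intro exI conjI refl) (auto intro!: rational_fps_mult rational_fps_shift assms(5))
  qed
  then obtain b g where
    b: "\<And>d. d \<in> R \<Longrightarrow> rational_fps (b d)" and
    g: "\<And>d w. d \<in> R \<Longrightarrow> w \<in> W \<Longrightarrow> rational_fps (g d w)" and
    H: "\<And>d. d \<in> R \<Longrightarrow> ?H d = b d + (\<Sum>w\<in>W. g d w * ?H w)"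
    by metis
  define S where "S c = {d \<in> R. edge_mult B c d > 0}" for c
  define b' where "b' c = 1 + fps_X * (\<Sum>d\<in>S c. of_nat (edge_mult B c d) * b d)" for c
  define C where "C c w = (\<Sum>d\<in>S c. of_nat (edge_mult B c d) * g d w)" for c w
  \<comment> \<open>The affine forms are inserted after one step down the tree. This step supplies
    the factor \<open>fps_X\<close> that the elimination requires; for a node of \<open>W\<close>
    the trivial affine form alone lacks it.\<close>
  have eq: "?H c = b' c + fps_X * (\<Sum>w\<in>W. C c w * ?H w)" for c
  proof -
    have "?H c = 1 + fps_X * (\<Sum>d\<in>S c. of_nat (edge_mult B c d) * ?H d)"
      unfolding S_def by (rule level_gf_digraph[OF assms(3) finite_out_neighbours[OF assms(3)]]) auto
    also have "(\<Sum>d\<in>S c. of_nat (edge_mult B c d) * ?H d) =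
        (\<Sum>d\<in>S c. of_nat (edge_mult B c d) * (b d + (\<Sum>w\<in>W. g d w * ?H w)))"
      by (rule sum.cong[OF refl], subst H) (auto simp: S_def)
    also have "\<dots> = (\<Sum>d\<in>S c. of_nat (edge_mult B c d) * b d) + (\<Sum>w\<in>W. C c w * ?H w)"
      unfolding C_def sum_distrib_left sum_distrib_right distrib_left sum.distrib
      by (subst (2) sum.swap) (simp add: mult.assoc)
    finally show ?thesis unfolding b'_def by (simp add: algebra_simps)
  qed
  have HW: "rational_fps (?H w)" if "w \<in> W" for w
  proof (rule rational_fps_linear_system[where b = b' and C = C and F = ?H, OF W _ _ _ that])
    show "?H c = b' c + fps_X * (\<Sum>w\<in>W. C c w * ?H w)" for c
      by (rule eq)
    show "rational_fps (b' c)" for c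
      unfolding b'_def by (intro rational_fps_intros b) (auto simp: S_def)
    show "rational_fps (C c u)" if "u \<in> W" for c u
      unfolding C_def by (intro rational_fps_intros g that) (auto simp: S_def)
  qed
  have "[1] \<in> avoiders B"
    using tree_level_root[OF assms(1,2), of 0] by (auto simp: avoiders_iff)
  \<comment> \<open>The root's series equals that of its representative, to which the affine form
    applies.\<close>
  then obtain \<rho> where \<rho>: "\<rho> \<in> R" "tree_equivalent B [1] \<rho>"
    using assms(3) unfolding class_representatives_def by blast
  have "rational_fps (?H \<rho>)"
    by (subst H[OF \<rho>(1)]) (intro rational_fps_intros b g HW \<rho>(1))
  then show ?thesis
    unfolding avoiders_gf_eq_level_gf[OF assms(1,2)] tree_equivalent_level_gf[OF \<rho>(2)]
    by (simp add: rational_fps_mult)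
qed

end
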